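(* Let $t\ge 4$ be a fixed constant. There is an efficient polynomial-time approximation scheme for \textsc{Max Dense Graph Partition} on graphs $G$ with $n$ vertices and minimum degree $\delta(G)=n-t$: for every $\varepsilon>0$ there is an algorithm running in time $O(g(1/\varepsilon)\,\mathrm{poly}(n))$ for some function $g$ that outputs a partition $\mathcal{P}$ with $\mathrm{opt}(G)/d(\mathcal{P})\le 1+\varepsilon$.
   Context: All graphs are finite, simple, undirected. For $S\subseteq V$, $d(S)=|E(S)|/|S|$ where $E(S)$ is the set of edges with both endpoints in $S$. For a partition $\mathcal{P}=\{V_1,\dots,V_k\}$ ($k\ge1$) of $V$ into nonempty parts, $d(\mathcal{P})=\sum_i d(V_i)$. \textsc{Max Dense Graph Partition}: given $G$, find a partition (any number of parts) maximizing $d(\mathcal{P})$; $\mathrm{opt}(G)$ denotes the maximum. *)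

theory Defs
  imports Complex_Main "HOL-Library.Disjoint_Sets" "HOL-Computational_Algebra.Polynomial"
begin

section \<open>Dense graph partitions\<close>

definition fin_simple_graph :: "'a set \<Rightarrow> 'a set set \<Rightarrow> bool" where
  "fin_simple_graph V E \<longleftrightarrow> finite V \<and> (\<forall>e\<in>E. e \<subseteq> V \<and> card e = 2)"

definition vertex_degree :: "'a set set \<Rightarrow> 'a \<Rightarrow> nat" where
  "vertex_degree E v = card {e \<in> E. v \<in> e}"

definition min_degree :: "'a set \<Rightarrow> 'a set set \<Rightarrow> nat" where
  "min_degree V E = Min (vertex_degree E ` V)"

definition density :: "'a set set \<Rightarrow> 'a set \<Rightarrow> real" where
  "density E S = real (card {e \<in> E. e \<subseteq> S}) / real (card S)"

definition partition_density :: "'a set set \<Rightarrow> 'a set set \<Rightarrow> real" where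
  "partition_density E P = (\<Sum>S\<in>P. density E S)"

definition opt :: "'a set \<Rightarrow> 'a set set \<Rightarrow> real" where
  "opt V E = Max (partition_density E ` {P. partition_on V P})"

section \<open>Random access machines\<close>

text \<open>
  A state consists of registers, addressed by constants in the program, and of a memory,
  addressed indirectly through registers.  Both hold natural numbers.  Every elementary
  instruction and every test costs one unit.  There is deliberately no unit-cost
  multiplication: a run of \<open>T\<close> steps then only lengthens numbers by \<open>O(T)\<close> bits, so that
  the running times are polynomially related to those of Turing machines.
\<close>

type_synonym state = "(nat \<Rightarrow> nat) \<times> (nat \<Rightarrow> nat)"

datatype ram =
    Const nat nat
  | Add nat nat nat
  | Sub nat nat nat
  | Load nat nat
  | Store nat nat
  | Seq ram ram
  | IfZero nat ram ram
  | WhileNonzero nat ram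

text \<open>
  \<open>exec c s T s'\<close>: started in \<open>s\<close>, the program \<open>c\<close> halts in \<open>s'\<close> after exactly \<open>T\<close> steps.
  Subtraction is truncated at zero.
\<close>

inductive exec :: "ram \<Rightarrow> state \<Rightarrow> nat \<Rightarrow> state \<Rightarrow> bool" where
  Const: "exec (Const i k) (r, m) 1 (r(i := k), m)"
| Add: "exec (Add i j k) (r, m) 1 (r(i := r j + r k), m)"
| Sub: "exec (Sub i j k) (r, m) 1 (r(i := r j - r k), m)"
| Load: "exec (Load i j) (r, m) 1 (r(i := m (r j)), m)"
| Store: "exec (Store i j) (r, m) 1 (r, m(r i := r j))"
| Seq: "exec c s T s' \<Longrightarrow> exec d s' U s'' \<Longrightarrow> exec (Seq c d) s (T + U) s''"
| If_zero: "fst s i = 0 \<Longrightarrow> exec c s T s' \<Longrightarrow> exec (IfZero i c d) s (Suc T) s'"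
| If_nonzero: "fst s i \<noteq> 0 \<Longrightarrow> exec d s T s' \<Longrightarrow> exec (IfZero i c d) s (Suc T) s'"
| While_zero: "fst s i = 0 \<Longrightarrow> exec (WhileNonzero i c) s 1 s"
| While_nonzero: "fst s i \<noteq> 0 \<Longrightarrow> exec c s T s' \<Longrightarrow> exec (WhileNonzero i c) s' U s'' \<Longrightarrow>
    exec (WhileNonzero i c) s (Suc (T + U)) s''"

inductive_cases exec_elims:
  "exec (Const i k) s T s'"
  "exec (Add i j k) s T s'"
  "exec (Sub i j k) s T s'"
  "exec (Load i j) s T s'"
  "exec (Store i j) s T s'"
  "exec (Seq c d) s T s'"
  "exec (IfZero i c d) s T s'"
  "exec (WhileNonzero i c) s T s'"

lemma exec_deterministic:
  "exec c s T s' \<Longrightarrow> exec c s U s'' \<Longrightarrow> U = T \<and> s'' = s'"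
proof (induction arbitrary: U s'' rule: exec.induct)
  case (Seq c s T s' d V s1)
  from Seq.prems obtain T' V' s2
    where *: "U = T' + V'" "exec c s T' s2" "exec d s2 V' s''"
    by (rule exec_elims(6))
  from Seq.IH(1)[OF *(2)] have "T' = T" "s2 = s'" by simp_all
  with Seq.IH(2) * show ?case by simp
next
  case (If_zero s i c T s' d)
  obtain T' where *: "U = Suc T'" "exec c s T' s''"
    using If_zero.hyps(1) by - (rule exec_elims(7)[OF If_zero.prems]; auto)
  with If_zero.IH[OF *(2)] show ?case by simp
next
  case (If_nonzero s i d T s' c)
  obtain T' where *: "U = Suc T'" "exec d s T' s''"
    using If_nonzero.hyps(1) by - (rule exec_elims(7)[OF If_nonzero.prems]; auto)
  with If_nonzero.IH[OF *(2)] show ?case by simp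
next
  case (While_zero s i c)
  from While_zero.prems show ?case
    by (rule exec_elims(8)) (simp_all add: While_zero.hyps)
next
  case (While_nonzero s i c T s' V s1)
  obtain T' V' s2
    where *: "U = Suc (T' + V')" "exec c s T' s2" "exec (WhileNonzero i c) s2 V' s''"
    using While_nonzero.hyps(1) by - (rule exec_elims(8)[OF While_nonzero.prems]; auto)
  from While_nonzero.IH(1)[OF *(2)] have "T' = T" "s2 = s'" by simp_all
  with While_nonzero.IH(2) * show ?case by simp
next
  case Const
  then show ?case by (rule exec_elims(1)) simp
next
  case Add
  then show ?case by (rule exec_elims(2)) simp
next
  case Sub
  then show ?case by (rule exec_elims(3)) simp
next
  case Load
  then show ?case by (rule exec_elims(4)) simp
next
  case Store
  then show ?case by (rule exec_elims(5)) simp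
qed

text \<open>
  A graph on the vertices \<open>0, \<dots>, n - 1\<close> is presented as its order, in register 0, and its
  adjacency matrix, stored row by row in the memory cells \<open>0, \<dots>, n\<^sup>2 - 1\<close>.
\<close>

definition input_state :: "nat \<Rightarrow> nat set set \<Rightarrow> state" where
  "input_state n E =
    ((\<lambda>i. if i = 0 then n else 0),
     (\<lambda>a. if a < n * n \<and> {a div n, a mod n} \<in> E then 1 else 0))"

text \<open>
  A partition is returned as a labelling: vertices \<open>u, v < n\<close> are in the same part iff the
  memory cells \<open>u\<close> and \<open>v\<close> of the final state agree.
\<close>

definition output_partition :: "nat \<Rightarrow> state \<Rightarrow> nat set set" where
  "output_partition n s = (\<lambda>u. {v. v < n \<and> snd s v = snd s u}) ` {..<n}"

lemma partition_on_output_partition: "partition_on {..<n} (output_partition n s)"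
  by (rule partition_onI) (auto simp: output_partition_def disjnt_def)

end

theory Submission
  imports Defs
begin

text \<open>
  A partition into \<open>k\<close> parts has density at most \<open>(n - k) / 2\<close>, attained by cliques, so
  \<open>opt \<le> (n - 1) / 2\<close>, whereas the one-part partition has density at least \<open>(n - t) / 2\<close> by the
  handshake lemma.  For \<open>n \<ge> t + t / \<epsilon>\<close> the one-part partition is therefore good enough, and it
  is written down in linear time.  Only finitely many graphs are smaller than this, and for them
  the program contains a decision tree on the adjacency matrix whose leaves write an optimal
  partition; its size depends on \<open>\<epsilon>\<close> only and is absorbed in \<open>g\<close>.
\<close>

section \<open>Densities\<close>

lemma fin_simple_graph_finite_edges:
  assumes "fin_simple_graph V E"
  shows "finite E"
  using assms unfolding fin_simple_graph_def by (metis PowI finite_Pow_iff finite_subset subsetI)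

text \<open>At most all \<open>card S choose 2\<close> pairs inside \<open>S\<close> are edges.
  Nonemptiness matters: division by zero gives the empty set density 0, above the bound
  -1/2.\<close>

lemma density_le:
  assumes "fin_simple_graph V E" "S \<subseteq> V" "S \<noteq> {}"
  shows "density E S \<le> (real (card S) - 1) / 2"
proof -
  have fin: "finite S"
    using assms finite_subset by (auto simp: fin_simple_graph_def)
  then have pos: "card S > 0"
    using assms by (simp add: card_gt_0_iff)
  have "card {e \<in> E. e \<subseteq> S} \<le> card {e. e \<subseteq> S \<and> card e = 2}"
    using assms(1) fin by (intro card_mono) (auto simp: fin_simple_graph_def)
  also have "\<dots> = card S choose 2"
    using fin by (rule n_subsets)
  also have "real (card S choose 2) = real (card S) * (real (card S) - 1) / 2"
    using choose_two[of "card S"] pos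
    by (simp add: real_of_nat_div of_nat_diff)
  finally have "real (card {e \<in> E. e \<subseteq> S}) \<le> real (card S) * (real (card S) - 1) / 2"
    by simp
  then show ?thesis
    using pos by (simp add: density_def field_simps)
qed

text \<open>Summed over the parts, the clique bound gives \<open>(card V - card P) / 2\<close>,
  since the sizes add up to \<open>card V\<close> and each part costs 1/2. A nonempty
  \<open>V\<close> has at least one part.\<close>

lemma partition_density_le:
  assumes "fin_simple_graph V E" "partition_on V P" "V \<noteq> {}"
  shows "partition_density E P \<le> (real (card V) - 1) / 2"
proof -
  have finV: "finite V"
    using assms(1) by (simp add: fin_simple_graph_def)
  have finP: "finite P"
    using finV assms(2) by (rule finite_elements)
  have "P \<noteq> {}"
    using assms(2,3) by (auto simp: partition_on_def)
  then have "card P \<ge> 1"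
    using finP by (simp add: Suc_le_eq card_gt_0_iff)
  have "(\<Sum>S\<in>P. card S) = card V"
  proof (rule product_partition[OF assms(2), symmetric])
    fix S assume "S \<in> P"
    then show "finite S"
      using finV assms(2) by (auto simp: partition_on_def intro: finite_subset)
  qed
  moreover have "partition_density E P \<le> (\<Sum>S\<in>P. (real (card S) - 1) / 2)"
    unfolding partition_density_def
    by (rule sum_mono, rule density_le[OF assms(1)])
      (use assms(2) in \<open>auto simp: partition_on_def\<close>)
  moreover have "(\<Sum>S\<in>P. (real (card S) - 1) / 2) = (real (\<Sum>S\<in>P. card S) - real (card P)) / 2"
    by (simp add: sum_divide_distrib[symmetric] sum_subtractf)
  ultimately show ?thesis
    using \<open>card P \<ge> 1\<close> by simp
qed

section \<open>Lower bound for the density of the whole vertex set\<close>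

lemma handshake:
  assumes "fin_simple_graph V E"
  shows "(\<Sum>v\<in>V. vertex_degree E v) = 2 * card E"
proof -
  have "(\<Sum>v\<in>V. vertex_degree E v) = (\<Sum>v\<in>V. \<Sum>e\<in>E. if v \<in> e then 1 else 0)"
    using fin_simple_graph_finite_edges[OF assms]
    by (simp add: vertex_degree_def sum.If_cases Int_def)
  also have "\<dots> = (\<Sum>e\<in>E. \<Sum>v\<in>V. if v \<in> e then 1 else 0)"
    \<comment> \<open>Double counting: incidences are now counted by edge, and each edge has two
      endpoints.\<close>
    by (rule sum.swap)
  also have "\<dots> = (\<Sum>e\<in>E. 2)"
  proof (rule sum.cong[OF refl])
    fix e assume "e \<in> E"
    then have "e \<subseteq> V" "card e = 2" "finite V"
      using assms by (auto simp: fin_simple_graph_def)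
    moreover from this have "{v \<in> V. v \<in> e} = e"
      by auto
    ultimately show "(\<Sum>v\<in>V. if v \<in> e then 1 else 0) = (2::nat)"
      by (simp add: sum.If_cases Int_def)
  qed
  finally show ?thesis by simp
qed

text \<open>By the handshake lemma the density of \<open>V\<close> is half the average degree, which
  is at least the minimum degree.\<close>

lemma density_whole_ge:
  assumes "fin_simple_graph V E" "V \<noteq> {}"
  shows "density E V \<ge> real (min_degree V E) / 2"
proof -
  have finV: "finite V"
    using assms(1) by (simp add: fin_simple_graph_def)
  have "card V * min_degree V E \<le> (\<Sum>v\<in>V. vertex_degree E v)"
    using finV sum_bounded_below[of V "min_degree V E" "vertex_degree E"]
    by (simp add: min_degree_def)
  then have "card V * min_degree V E \<le> 2 * card E"
    by (simp add: handshake[OF assms(1)])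
  then have "real (card V) * real (min_degree V E) \<le> 2 * real (card E)"
    by (metis of_nat_le_iff of_nat_mult of_nat_numeral)
  moreover have "{e \<in> E. e \<subseteq> V} = E"
    using assms(1) by (auto simp: fin_simple_graph_def)
  moreover have "card V > 0"
    using finV assms(2) by (simp add: card_gt_0_iff)
  ultimately show ?thesis
    by (simp add: density_def field_simps)
qed

section \<open>The optimum compared with the one-part partition\<close>

lemma opt_attained:
  assumes "finite V"
  obtains P where "partition_on V P" "opt V E = partition_density E P"
proof -
  \<comment> \<open>The partition into singletons witnesses nonemptiness, so the \<open>Max\<close>
    in \<open>opt\<close> is a genuine maximum.\<close>
  have "finite {P. partition_on V P}" "{P. partition_on V P} \<noteq> {}"
    using assms finitely_many_partition_on partition_on_singletons[of V] by auto
  then have "opt V E \<in> partition_density E ` {P. partition_on V P}"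
    unfolding opt_def by (intro Max_in) auto
  with that show thesis by auto
qed

lemma opt_le_density_whole:
  fixes \<epsilon> :: real
  assumes "fin_simple_graph V E" "V \<noteq> {}" "min_degree V E = card V - t"
    and "\<epsilon> > 0" "real (card V) \<ge> real t + real t / \<epsilon>"
  shows "opt V E \<le> (1 + \<epsilon>) * density E V"
proof -
  have "finite V"
    using assms(1) by (simp add: fin_simple_graph_def)
  then have "opt V E \<le> (real (card V) - 1) / 2"
    using opt_attained partition_density_le[OF assms(1) _ assms(2)] by metis
  also have "\<dots> \<le> (1 + \<epsilon>) * ((real (card V) - real t) / 2)"
  proof -
    \<comment> \<open>\<open>y\<close> is twice what the factor \<open>1 + \<epsilon>\<close> adds
      to \<open>(card V - t) / 2\<close>. A value of \<open>t - 1\<close> would close the gap to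
      \<open>(card V - 1) / 2\<close>; the threshold on \<open>card V\<close> yields
      \<open>t\<close>.\<close>
    define y where "y = \<epsilon> * (real (card V) - real t)"
    have "\<epsilon> * (real t / \<epsilon>) \<le> y"
      unfolding y_def using assms(4,5) by (intro mult_left_mono) auto
    then have "real t \<le> y"
      using assms(4) by simp
    moreover have "(1 + \<epsilon>) * ((real (card V) - real t) / 2) = (real (card V) - real t + y) / 2"
      by (simp add: y_def algebra_simps)
    ultimately show ?thesis
      by simp
  qed
  also have "\<dots> \<le> (1 + \<epsilon>) * density E V"
    using density_whole_ge[OF assms(1,2)] assms(3,4)
    by (intro mult_left_mono) auto
  finally show ?thesis .
qed

section \<open>Programs\<close>

text \<open>Register 0 counts down and is decremented before each store, so the cells
  \<open>r 0 - 1\<close> down to 0 are visited. Registers 2 and 3 supply the constants 1 and 0, as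
  instructions act on registers only. A round costs a test and two instructions; the last test costs
  one more step.\<close>

lemma exec_zero_cells:
  assumes "r 2 = 1" "r 3 = 0"
  shows "\<exists>r'. exec (WhileNonzero 0 (Seq (Sub 0 0 2) (Store 0 3))) (r, m) (3 * r 0 + 1)
    (r', \<lambda>a. if a < r 0 then 0 else m a)"
  using assms
proof (induction "r 0" arbitrary: r m)
  case 0
  then show ?case
    using exec.While_zero[of "(r, m)" 0 "Seq (Sub 0 0 2) (Store 0 3)"] by auto
next
  case (Suc k)
  let ?r = "r(0 := k)" and ?m = "m(k := 0)"
  have "exec (Sub 0 0 2) (r, m) 1 (?r, m)"
    using exec.Sub[of 0 0 2 r m] Suc.prems Suc.hyps(2)[symmetric] by simp
  moreover have "exec (Store 0 3) (?r, m) 1 (?r, ?m)"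
    using exec.Store[of 0 3 ?r m] Suc.prems by simp
  ultimately have "exec (Seq (Sub 0 0 2) (Store 0 3)) (r, m) (1 + 1) (?r, ?m)"
    by (rule exec.Seq)
  moreover obtain r' where
    "exec (WhileNonzero 0 (Seq (Sub 0 0 2) (Store 0 3))) (?r, ?m) (3 * k + 1)
      (r', \<lambda>a. if a < k then 0 else ?m a)"
    using Suc.hyps(1)[of ?r ?m] Suc.prems by auto
  ultimately have "exec (WhileNonzero 0 (Seq (Sub 0 0 2) (Store 0 3))) (r, m)
      (Suc (1 + 1 + (3 * k + 1))) (r', \<lambda>a. if a < k then 0 else ?m a)"
    using Suc.hyps(2) by (intro exec.While_nonzero) auto
  moreover have "(\<lambda>a. if a < k then 0 else ?m a) = (\<lambda>a. if a < r 0 then 0 else m a)"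
    using Suc.hyps(2) by auto
  moreover have "Suc (1 + 1 + (3 * k + 1)) = 3 * r 0 + 1"
    using Suc.hyps(2) by simp
  ultimately show ?case by metis
qed

text \<open>Equal labels in all cells below \<open>n\<close> encode the one-part partition. Loading
  the two constants adds two steps to the loop.\<close>

lemma ex_zeroing_program:
  "\<exists>A. \<forall>r m. \<exists>s. exec A (r, m) (3 * r 0 + 3) s \<and> (\<forall>u<r 0. snd s u = 0)"
proof (intro exI[of _ "Seq (ram.Const 2 1) (Seq (ram.Const 3 0)
      (WhileNonzero 0 (Seq (Sub 0 0 2) (Store 0 3))))"] allI)
  fix r m :: "nat \<Rightarrow> nat"
  let ?r = "r(2 := 1, 3 := 0)"
  obtain r' where "exec (WhileNonzero 0 (Seq (Sub 0 0 2) (Store 0 3))) (?r, m) (3 * ?r 0 + 1)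
    (r', \<lambda>a. if a < ?r 0 then 0 else m a)"
    using exec_zero_cells[of ?r m] by auto
  then have "exec (Seq (ram.Const 2 1) (Seq (ram.Const 3 0)
      (WhileNonzero 0 (Seq (Sub 0 0 2) (Store 0 3))))) (r, m)
      (1 + (1 + (3 * ?r 0 + 1))) (r', \<lambda>a. if a < ?r 0 then 0 else m a)"
    by (intro exec.Seq) (rule exec.Const)+
  then show "\<exists>s. exec (Seq (ram.Const 2 1) (Seq (ram.Const 3 0)
      (WhileNonzero 0 (Seq (Sub 0 0 2) (Store 0 3))))) (r, m) (3 * r 0 + 3) s \<and>
      (\<forall>u<r 0. snd s u = 0)"
    by (intro exI[of _ "(r', \<lambda>a. if a < ?r 0 then 0 else m a)"]) (simp add: eval_nat_numeral)
qed

text \<open>Here \<open>n\<close> and \<open>f\<close> are known when the program is chosen, so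
  straight-line code suffices: per cell, load the address, load the value, store.\<close>

lemma ex_writing_program:
  fixes f :: "nat \<Rightarrow> nat"
  shows "\<exists>A. \<forall>s. \<exists>s'. exec A s (3 * n + 1) s' \<and> (\<forall>u<n. snd s' u = f u)"
proof (induction n)
  case 0
  \<comment> \<open>There is no empty program, so a dummy \<open>Const\<close> is run; this is the
    \<open>+ 1\<close> in the running time.\<close>
  then show ?case by (metis Const mult_zero_right add_0 not_less0 surj_pair)
next
  case (Suc n)
  then obtain A where A: "\<forall>s. \<exists>s'. exec A s (3 * n + 1) s' \<and> (\<forall>u<n. snd s' u = f u)"
    by blast
  let ?A = "Seq A (Seq (ram.Const 1 n) (Seq (ram.Const 2 (f n)) (Store 1 2)))"
  have "\<exists>s'. exec ?A s (3 * Suc n + 1) s' \<and> (\<forall>u<Suc n. snd s' u = f u)" for s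
  proof -
    obtain r m where rm: "exec A s (3 * n + 1) (r, m)" "\<forall>u<n. m u = f u"
      using A by (metis snd_conv surj_pair)
    let ?r = "r(1 := n, 2 := f n)"
    have "exec ?A s (3 * n + 1 + (1 + (1 + 1))) (?r, m(?r 1 := ?r 2))"
      by (rule exec.Seq[OF rm(1) exec.Seq[OF exec.Const exec.Seq[OF exec.Const exec.Store]]])
    moreover have "3 * n + 1 + (1 + (1 + 1)) = 3 * Suc n + 1"
      by simp
    ultimately have "exec ?A s (3 * Suc n + 1) (?r, m(?r 1 := ?r 2))"
      by (simp only:)
    moreover have "\<forall>u<Suc n. snd (?r, m(?r 1 := ?r 2)) u = f u"
      using rm(2) by (simp add: less_Suc_eq)
    ultimately show ?thesis by blast
  qed
  then show ?case by blast
qed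

text \<open>\<open>A\<close> is a binary decision tree of depth \<open>k\<close> over the cells
  below \<open>k\<close>, with the programs \<open>F X\<close> as leaves. A run follows a single
  path at three steps per level (\<open>Const\<close>, \<open>Load\<close>, test), however large the
  tree is. The memory is left intact, but register 1 is overwritten, whence
  \<open>r'\<close>.\<close>

lemma ex_dispatch_program:
  fixes F :: "nat set \<Rightarrow> ram"
  shows "\<exists>A. \<forall>r m. \<exists>r'. \<forall>T s.
    exec (F {a. a < k \<and> m a \<noteq> 0}) (r', m) T s \<longrightarrow> exec A (r, m) (T + 3 * k) s"
proof (induction k arbitrary: F)
  case 0
  show ?case by (intro exI[of _ "F {}"]) auto
next
  case (Suc k)
  obtain A where A: "\<forall>r m. \<exists>r'. \<forall>T s.
      exec (F {a. a < k \<and> m a \<noteq> 0}) (r', m) T s \<longrightarrow> exec A (r, m) (T + 3 * k) s"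
    using Suc by blast
  \<comment> \<open>The nonzero branch records its finding by building the subtree for the leaves
    \<open>F (insert k X)\<close>; hence the induction generalises over \<open>F\<close>.\<close>
  obtain B where B: "\<forall>r m. \<exists>r'. \<forall>T s.
      exec (F (insert k {a. a < k \<and> m a \<noteq> 0})) (r', m) T s \<longrightarrow> exec B (r, m) (T + 3 * k) s"
    using Suc[of "\<lambda>X. F (insert k X)"] by blast
  let ?A = "Seq (ram.Const 1 k) (Seq (Load 1 1) (IfZero 1 A B))"
  have "\<exists>r'. \<forall>T s. exec (F {a. a < Suc k \<and> m a \<noteq> 0}) (r', m) T s \<longrightarrow>
      exec ?A (r, m) (T + 3 * Suc k) s" for r m
  proof -
    let ?r0 = "r(1 := k)"
    let ?r = "?r0(1 := m (?r0 1))"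
    have step: "exec ?A (r, m) (T + 3 * Suc k) s"
      if "exec (IfZero 1 A B) (?r, m) (Suc (T + 3 * k)) s" for T s
    proof -
      have "exec ?A (r, m) (1 + (1 + Suc (T + 3 * k))) s"
        by (rule exec.Seq[OF exec.Const exec.Seq[OF exec.Load that]])
      then show ?thesis by (simp add: eval_nat_numeral)
    qed
    show ?thesis
    proof (cases "m k = 0")
      case True
      then have "{a. a < Suc k \<and> m a \<noteq> 0} = {a. a < k \<and> m a \<noteq> 0}"
        by (auto simp: less_Suc_eq)
      moreover obtain r' where "\<And>T s. exec (F {a. a < k \<and> m a \<noteq> 0}) (r', m) T s \<Longrightarrow>
          exec A (?r, m) (T + 3 * k) s"
        using A by blast
      moreover have "fst (?r, m) 1 = 0"
        using True by simp
      ultimately show ?thesis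
        using step[OF exec.If_zero] by (auto intro: exI[of _ r'])
    next
      case False
      then have "{a. a < Suc k \<and> m a \<noteq> 0} = insert k {a. a < k \<and> m a \<noteq> 0}"
        by (auto simp: less_Suc_eq)
      moreover obtain r' where
        "\<And>T s. exec (F (insert k {a. a < k \<and> m a \<noteq> 0})) (r', m) T s \<Longrightarrow>
          exec B (?r, m) (T + 3 * k) s"
        using B by blast
      moreover have "fst (?r, m) 1 \<noteq> 0"
        using False by simp
      ultimately show ?thesis
        using step[OF exec.If_nonzero] by (auto intro: exI[of _ r'])
    qed
  qed
  then show ?case by blast
qed

section \<open>Small graphs\<close>

text \<open>Decoding cell numbers by \<open>div\<close> and \<open>mod\<close> recovers the graph
  from the set of nonzero cells, so a leaf of the decision tree knows the whole of \<open>E\<close>.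
  An edge \<open>{u, v}\<close> is found at cell \<open>u * n + v\<close>.\<close>

lemma edges_from_input_state:
  assumes "fin_simple_graph {..<n} E"
  shows "(\<lambda>a. {a div n, a mod n}) ` {a. a < n * n \<and> snd (input_state n E) a \<noteq> 0} = E"
proof
  show "(\<lambda>a. {a div n, a mod n}) ` {a. a < n * n \<and> snd (input_state n E) a \<noteq> 0} \<subseteq> E"
    by (auto simp: input_state_def split: if_splits)
  show "E \<subseteq> (\<lambda>a. {a div n, a mod n}) ` {a. a < n * n \<and> snd (input_state n E) a \<noteq> 0}"
  proof
    fix e assume e: "e \<in> E"
    with assms have "e \<subseteq> {..<n}" "card e = 2"
      by (auto simp: fin_simple_graph_def)
    then obtain u v where uv: "e = {u, v}" "u < n" "v < n"
      by (auto simp: card_2_iff)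
    have "u * n + v < Suc u * n"
      using uv by simp
    also have "\<dots> \<le> n * n"
      using uv by (intro mult_le_mono1) simp
    finally show "e \<in> (\<lambda>a. {a div n, a mod n}) `
        {a. a < n * n \<and> snd (input_state n E) a \<noteq> 0}"
      using uv e by (intro image_eqI[of _ _ "u * n + v"]) (auto simp: input_state_def)
  qed
qed

text \<open>Each vertex is labelled by the least element of its part; disjoint parts have different
  minima.\<close>

lemma ex_labelling:
  assumes "partition_on {..<n} P"
  shows "\<exists>f. \<forall>s. (\<forall>u<n. snd s u = f u) \<longrightarrow> output_partition n s = P"
proof (intro exI allI impI)
  fix s :: state
  let ?part = "\<lambda>u. THE S. S \<in> P \<and> u \<in> S"
  have part: "?part u = S" if "S \<in> P" "u \<in> S" for u S
    using that assms by (intro the_equality) (auto simp: partition_on_def disjoint_def)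
  \<comment> \<open>This assumption instantiates the labelling left open by
    \<open>exI\<close>.\<close>
  assume s: "\<forall>u<n. snd s u = Min (?part u)"
  have cls: "{v. v < n \<and> snd s v = snd s u} = S" if "S \<in> P" "u \<in> S" for u S
  proof -
    have Min_mem: "Min X \<in> X" if "X \<in> P" for X
    proof (rule Min_in)
      show "finite X" "X \<noteq> {}"
        using that assms finite_subset[of X "{..<n}"] by (auto simp: partition_on_def)
    qed
    have lt: "v < n" if "v \<in> X" "X \<in> P" for v X
      using that assms by (auto simp: partition_on_def)
    have label: "snd s v = Min X" if "v \<in> X" "X \<in> P" for v X
      using s lt[OF that] part[OF that(2,1)] by simp
    have "v \<in> S" if v: "v < n" "snd s v = snd s u" for v
    proof -
      obtain X where X: "X \<in> P" "v \<in> X"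
        using v assms by (auto simp: partition_on_def)
      then have "Min X = Min S"
        using v label[of v X] label[of u S] \<open>S \<in> P\<close> \<open>u \<in> S\<close> by simp
      \<comment> \<open>The common minimum lies in both parts, so disjointness, in the form of
        \<open>part\<close>, identifies them.\<close>
      then have "X = S"
        using Min_mem[OF X(1)] Min_mem[OF \<open>S \<in> P\<close>] part X(1) \<open>S \<in> P\<close> by metis
      with X show ?thesis by simp
    qed
    moreover have "snd s v = snd s u" if "v \<in> S" for v
      using that label[of _ S] \<open>S \<in> P\<close> \<open>u \<in> S\<close> by simp
    ultimately show ?thesis
      using lt \<open>S \<in> P\<close> by blast
  qed
  show "output_partition n s = P"
  proof
    show "output_partition n s \<subseteq> P"
    proof
      fix X assume "X \<in> output_partition n s"
      then obtain u where u: "u < n" "X = {v. v < n \<and> snd s v = snd s u}"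
        by (auto simp: output_partition_def)
      then obtain S where "S \<in> P" "u \<in> S"
        using assms by (auto simp: partition_on_def)
      with u cls show "X \<in> P" by metis
    qed
    show "P \<subseteq> output_partition n s"
    proof
      fix S assume S: "S \<in> P"
      then have "S \<noteq> {}" "S \<subseteq> {..<n}"
        using assms by (auto simp: partition_on_def)
      then obtain u where u: "u \<in> S" "u < n"
        by auto
      have "S = {v. v < n \<and> snd s v = snd s u}"
        using cls S u(1) by simp
      with u(2) show "S \<in> output_partition n s"
        by (simp add: output_partition_def)
    qed
  qed
qed

text \<open>For fixed \<open>n\<close> an optimal partition for every edge set can be hard-wired:
  the tree over the \<open>n * n\<close> matrix cells costs \<open>3 * (n * n)\<close> steps, and
  its leaf writes the labels in \<open>3 * n + 1\<close>. Only existence of the program is claimed,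
  so choosing the optima needs no computation.\<close>

lemma ex_optimal_program:
  "\<exists>A. \<forall>r E. fin_simple_graph {..<n} E \<longrightarrow>
    (\<exists>s. exec A (r, snd (input_state n E)) (3 * n + 1 + 3 * (n * n)) s \<and>
      opt {..<n} E = partition_density E (output_partition n s))"
proof -
  \<comment> \<open>This holds for every set \<open>E\<close>, simple graph or not, so every leaf of
    the tree gets a program.\<close>
  have "\<exists>B. \<forall>s. \<exists>s'. exec B s (3 * n + 1) s' \<and>
      opt {..<n} E = partition_density E (output_partition n s')" for E
  proof -
    obtain P where P: "partition_on {..<n} P" "opt {..<n} E = partition_density E P"
      using opt_attained[of "{..<n}" E] by auto
    from ex_labelling[OF P(1)] obtain f
      where f: "\<forall>s. (\<forall>u<n. snd s u = f u) \<longrightarrow> output_partition n s = P" ..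
    from ex_writing_program[of n f] f P(2) show ?thesis by metis
  qed
  then obtain B where B: "\<And>E s. \<exists>s'. exec (B E) s (3 * n + 1) s' \<and>
      opt {..<n} E = partition_density E (output_partition n s')"
    by metis
  let ?dec = "\<lambda>X. (\<lambda>a. {a div n, a mod n}) ` X"
  obtain A where A: "\<forall>r m. \<exists>r'. \<forall>T s.
      exec (B (?dec {a. a < n * n \<and> m a \<noteq> 0})) (r', m) T s \<longrightarrow> exec A (r, m) (T + 3 * (n * n)) s"
    using ex_dispatch_program[of "\<lambda>X. B (?dec X)" "n * n"] by blast
  have "\<exists>s. exec A (r, snd (input_state n E)) (3 * n + 1 + 3 * (n * n)) s \<and>
      opt {..<n} E = partition_density E (output_partition n s)"
    if "fin_simple_graph {..<n} E" for r E
  proof -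
    note dec = edges_from_input_state[OF that]
    from A[rule_format, of "snd (input_state n E)" r, unfolded dec]
    obtain r' where "\<forall>T s. exec (B E) (r', snd (input_state n E)) T s \<longrightarrow>
        exec A (r, snd (input_state n E)) (T + 3 * (n * n)) s" by blast
    with B[of E "(r', snd (input_state n E))"] show ?thesis by blast
  qed
  then show ?thesis by blast
qed

section \<open>The approximation scheme\<close>

text \<open>The other registers are arbitrary, so that programs can be run after a test on the order.\<close>

definition approximates :: "nat \<Rightarrow> real \<Rightarrow> ram \<Rightarrow> nat \<Rightarrow> nat \<Rightarrow> bool" where
  "approximates t \<epsilon> A K n \<longleftrightarrow> (\<forall>r E. r 0 = n \<and> fin_simple_graph {..<n} E \<and> n \<ge> t \<and>
    min_degree {..<n} E = n - t \<longrightarrow>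
    (\<exists>T s. exec A (r, snd (input_state n E)) T s \<and> T \<le> K * (n + 1) \<and>
      opt {..<n} E \<le> (1 + \<epsilon>) * partition_density E (output_partition n s)))"

lemma partition_density_nonneg: "partition_density E P \<ge> 0"
  by (simp add: partition_density_def density_def sum_nonneg)

lemma ex_approximates_small:
  assumes "\<epsilon> > 0"
  shows "\<exists>A K. approximates t \<epsilon> A K n"
proof -
  obtain A where A: "\<forall>r E. fin_simple_graph {..<n} E \<longrightarrow>
      (\<exists>s. exec A (r, snd (input_state n E)) (3 * n + 1 + 3 * (n * n)) s \<and>
        opt {..<n} E = partition_density E (output_partition n s))"
    using ex_optimal_program[of n] by blast
  \<comment> \<open>With \<open>n\<close> fixed, the whole running time serves as the constant
    \<open>K\<close>.\<close>
  have "approximates t \<epsilon> A (3 * n + 1 + 3 * (n * n)) n"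
    unfolding approximates_def
  proof (intro allI impI)
    fix r :: "nat \<Rightarrow> nat" and E
    assume "r 0 = n \<and> fin_simple_graph {..<n} E \<and> n \<ge> t \<and> min_degree {..<n} E = n - t"
    then obtain s where s: "exec A (r, snd (input_state n E)) (3 * n + 1 + 3 * (n * n)) s"
      "opt {..<n} E = partition_density E (output_partition n s)"
      using A by blast
    then have "opt {..<n} E \<le> (1 + \<epsilon>) * partition_density E (output_partition n s)"
      using assms partition_density_nonneg[of E "output_partition n s"]
      by (simp add: algebra_simps)
    with s(1) show "\<exists>T s. exec A (r, snd (input_state n E)) T s \<and>
        T \<le> (3 * n + 1 + 3 * (n * n)) * (n + 1) \<and>
        opt {..<n} E \<le> (1 + \<epsilon>) * partition_density E (output_partition n s)"
      by (intro exI[of _ "3 * n + 1 + 3 * (n * n)"] exI[of _ s]) simp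
  qed
  then show ?thesis by blast
qed

lemma ex_approximates_large:
  assumes "\<epsilon> > 0" "t > 0"
  shows "\<exists>A K N. \<forall>n\<ge>N. approximates t \<epsilon> A K n"
proof -
  obtain A where A: "\<forall>r m. \<exists>s. exec A (r, m) (3 * r 0 + 3) s \<and> (\<forall>u<r 0. snd s u = 0)"
    using ex_zeroing_program by blast
  \<comment> \<open>The threshold is that of \<open>opt_le_density_whole\<close>, rounded up;
    \<open>K = 3\<close> because the zeroing program takes \<open>3 * n + 3\<close> steps.\<close>
  have "approximates t \<epsilon> A 3 n" if n: "n \<ge> nat \<lceil>real t + real t / \<epsilon>\<rceil>" for n
    unfolding approximates_def
  proof (intro allI impI)
    fix r :: "nat \<Rightarrow> nat" and E
    assume *: "r 0 = n \<and> fin_simple_graph {..<n} E \<and> n \<ge> t \<and> min_degree {..<n} E = n - t"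
    then obtain s where s: "exec A (r, snd (input_state n E)) (3 * n + 3) s" "\<forall>u<n. snd s u = 0"
      using A by metis
    \<comment> \<open>For \<open>n = 0\<close> the output would be the empty family instead of
      \<open>{{..<n}}\<close>.\<close>
    have "n > 0"
      using * assms(2) by simp
    then have "{..<n} \<noteq> {}"
      by auto
    have "output_partition n s = {{..<n}}"
      using s(2) \<open>n > 0\<close> by (auto simp: output_partition_def)
    moreover have "opt {..<n} E \<le> (1 + \<epsilon>) * density E {..<n}"
    proof (rule opt_le_density_whole)
      show "real (card {..<n}) \<ge> real t + real t / \<epsilon>"
        using n by (simp add: nat_ceiling_le_eq)
    qed (use * assms \<open>{..<n} \<noteq> {}\<close> in simp_all)
    ultimately show "\<exists>T s. exec A (r, snd (input_state n E)) T s \<and> T \<le> 3 * (n + 1) \<and>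
        opt {..<n} E \<le> (1 + \<epsilon>) * partition_density E (output_partition n s)"
      using s(1) by (intro exI[of _ "3 * n + 3"] exI[of _ s]) (simp add: partition_density_def)
  qed
  then show ?thesis by blast
qed

text \<open>The threshold \<open>N\<close> is lowered one order at a time: a test in front of the
  program diverts graphs of order exactly \<open>N\<close> to a program made for them. Finitely many
  such extensions reach 0, and the constant grows but stays independent of \<open>n\<close>.\<close>

lemma ex_approximates_all:
  assumes "\<epsilon> > 0" "\<forall>n\<ge>N. approximates t \<epsilon> A K n"
  shows "\<exists>A K. \<forall>n. approximates t \<epsilon> A K n"
  using assms(2)
proof (induction N arbitrary: A K)
  case 0
  then show ?case by auto
next
  case (Suc N)
  obtain B L where B: "approximates t \<epsilon> B L N"
    using ex_approximates_small[OF assms(1)] by blast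
  \<comment> \<open>Register 1 receives the truncated difference \<open>n - N\<close>, which for
    \<open>n \<ge> N\<close> vanishes iff \<open>n = N\<close>. Register 0 keeps \<open>n\<close>
    for the chosen branch.\<close>
  let ?A = "Seq (ram.Const 1 N) (Seq (Sub 1 0 1) (IfZero 1 B A))"
  have "approximates t \<epsilon> ?A (K + L + 3) n" if n: "n \<ge> N" for n
    unfolding approximates_def
  proof (intro allI impI)
    fix r :: "nat \<Rightarrow> nat" and E
    assume *: "r 0 = n \<and> fin_simple_graph {..<n} E \<and> n \<ge> t \<and> min_degree {..<n} E = n - t"
    let ?m = "snd (input_state n E)"
    let ?r0 = "r(1 := N)"
    let ?r = "?r0(1 := ?r0 0 - ?r0 1)"
    have r: "?r 0 = n" "?r 1 = n - N"
      using * by auto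
    have step: "exec ?A (r, ?m) (1 + (1 + Suc T)) s"
      if "exec (IfZero 1 B A) (?r, ?m) (Suc T) s" for T s
      by (rule exec.Seq[OF exec.Const exec.Seq[OF exec.Sub that]])
    have "\<exists>T s. exec (IfZero 1 B A) (?r, ?m) (Suc T) s \<and> T \<le> (K + L) * (n + 1) \<and>
        opt {..<n} E \<le> (1 + \<epsilon>) * partition_density E (output_partition n s)"
    proof (cases "n = N")
      case True
      with B have "approximates t \<epsilon> B L n" by simp
      with * r(1) obtain T s where s: "exec B (?r, ?m) T s" "T \<le> L * (n + 1)"
        "opt {..<n} E \<le> (1 + \<epsilon>) * partition_density E (output_partition n s)"
        unfolding approximates_def by blast
      have "exec (IfZero 1 B A) (?r, ?m) (Suc T) s"
        using True r(2) by (intro exec.If_zero s(1)) simp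
      moreover have "T \<le> (K + L) * (n + 1)"
        using s(2) by (simp add: algebra_simps)
      ultimately show ?thesis
        using s(3) by blast
    next
      case False
      with n Suc.prems have "approximates t \<epsilon> A K n" by simp
      with * r(1) obtain T s where s: "exec A (?r, ?m) T s" "T \<le> K * (n + 1)"
        "opt {..<n} E \<le> (1 + \<epsilon>) * partition_density E (output_partition n s)"
        unfolding approximates_def by blast
      have "exec (IfZero 1 B A) (?r, ?m) (Suc T) s"
        using False n r(2) by (intro exec.If_nonzero s(1)) simp
      moreover have "T \<le> (K + L) * (n + 1)"
        using s(2) by (simp add: algebra_simps)
      ultimately show ?thesis
        using s(3) by blast
    qed
    then obtain T s where s: "exec (IfZero 1 B A) (?r, ?m) (Suc T) s" "T \<le> (K + L) * (n + 1)"
      "opt {..<n} E \<le> (1 + \<epsilon>) * partition_density E (output_partition n s)"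
      by blast
    \<comment> \<open>The 3 in the new constant pays for \<open>Const\<close>, \<open>Sub\<close>
      and the test; \<open>K + L\<close> covers either branch.\<close>
    have "1 + (1 + Suc T) \<le> (K + L + 3) * (n + 1)"
      using s(2) by (simp add: algebra_simps)
    with step[OF s(1)] s(3) show "\<exists>T s. exec ?A (r, ?m) T s \<and> T \<le> (K + L + 3) * (n + 1) \<and>
        opt {..<n} E \<le> (1 + \<epsilon>) * partition_density E (output_partition n s)"
      by blast
  qed
  then show ?case
    by (intro Suc.IH) blast
qed

theorem theorem27:
  fixes t :: nat
  assumes "t \<ge> 4"
  shows "\<exists>(g :: real \<Rightarrow> real) (p :: real poly) (C :: real).
    \<forall>\<epsilon>>0. \<exists>A :: ram. \<forall>n (E :: nat set set).
      fin_simple_graph {..<n} E \<and> n \<ge> t \<and> min_degree {..<n} E = n - t \<longrightarrow>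
      (\<exists>T s. exec A (input_state n E) T s \<and>
        real T \<le> C * (g (1 / \<epsilon>) * poly p (real n)) \<and>
        partition_on {..<n} (output_partition n s) \<and>
        opt {..<n} E \<le> (1 + \<epsilon>) * partition_density E (output_partition n s))"
proof -
  have "\<forall>\<epsilon>>0. \<exists>A K. \<forall>n. approximates t \<epsilon> A K n"
  proof (intro allI impI)
    fix \<epsilon> :: real assume "\<epsilon> > 0"
    moreover from this obtain A K N where "\<forall>n\<ge>N. approximates t \<epsilon> A K n"
      using ex_approximates_large[of \<epsilon> t] assms by auto
    ultimately show "\<exists>A K. \<forall>n. approximates t \<epsilon> A K n"
      by (rule ex_approximates_all)
  qed
  \<comment> \<open>Choice turns program and constant into functions of \<epsilon>, which lets one
    function \<open>g\<close> serve all \<epsilon>.\<close>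
  then obtain A K where AK: "\<And>\<epsilon> n. \<epsilon> > 0 \<Longrightarrow> approximates t \<epsilon> (A \<epsilon>) (K \<epsilon>) n"
    by metis
  show ?thesis
  \<comment> \<open>The bound is read in terms of \<open>1 / \<epsilon>\<close>:
    \<open>g x = K (1 / x)\<close> gives \<open>g (1 / \<epsilon>) = K \<epsilon>\<close>. The
    polynomial is \<open>n + 1\<close>, and \<open>C = 1\<close>.\<close>
  proof (rule exI[of _ "\<lambda>x. real (K (1 / x))"], rule exI[of _ "[:1, 1:]"], rule exI[of _ 1],
      intro allI impI)
    fix \<epsilon> :: real assume "\<epsilon> > 0"
    show "\<exists>A. \<forall>n E. fin_simple_graph {..<n} E \<and> n \<ge> t \<and> min_degree {..<n} E = n - t \<longrightarrow>
      (\<exists>T s. exec A (input_state n E) T s \<and>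
        real T \<le> 1 * (real (K (1 / (1 / \<epsilon>))) * poly [:1, 1:] (real n)) \<and>
        partition_on {..<n} (output_partition n s) \<and>
        opt {..<n} E \<le> (1 + \<epsilon>) * partition_density E (output_partition n s))"
    proof (intro exI[of _ "A \<epsilon>"] allI impI)
      fix n E
      assume *: "fin_simple_graph {..<n} E \<and> n \<ge> t \<and> min_degree {..<n} E = n - t"
      have "fst (input_state n E) 0 = n"
        by (simp add: input_state_def)
      with * AK[OF \<open>\<epsilon> > 0\<close>, of n] obtain T s where s: "exec (A \<epsilon>) (input_state n E) T s"
        "T \<le> K \<epsilon> * (n + 1)"
        "opt {..<n} E \<le> (1 + \<epsilon>) * partition_density E (output_partition n s)"
        unfolding approximates_def by (metis prod.collapse)
      have "real T \<le> real (K \<epsilon>) * (1 + real n)"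
        using s(2) by (metis of_nat_1 of_nat_add of_nat_le_iff of_nat_mult add.commute)
      with s(1,3) partition_on_output_partition[of n s]
      show "\<exists>T s. exec (A \<epsilon>) (input_state n E) T s \<and>
        real T \<le> 1 * (real (K (1 / (1 / \<epsilon>))) * poly [:1, 1:] (real n)) \<and>
        partition_on {..<n} (output_partition n s) \<and>
        opt {..<n} E \<le> (1 + \<epsilon>) * partition_density E (output_partition n s)"
        by (intro exI[of _ T] exI[of _ s]) simp
    qed
  qed
qed

end
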